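(* Let $M$ be a set system on $[n]$. Then $M$ is a strong $\Delta$-matroid if and only if - it has no peerless antipode in any $3$-cube or $4$-cube, and - it has no isolated antipode in any $k$-cube for $k\ge5$.
   Context: A set system on $[n]=\{1,\dots,n\}$ is a (possibly empty) collection of subsets of $[n]$; $\triangle$ is symmetric difference (when $a=b$, $\{a,b\}=\{a\}$). A $\Delta$-matroid is a set system $M$ such that for all $A,B\in M$ and $a\in A\triangle B$ there exists $b\in A\triangle B$ (possibly $b=a$) with $A\triangle\{a,b\}\in M$. A $\Delta$-matroid $M$ is strong if it satisfies the hyperplane exchange property: for all distinct $A,B\in M$ there exist (possibly equal) $a,b\in A\triangle B$ such that $A\triangle\{a,b\}\in M$ and $B\triangle\{a,b\}\in M$. For $S\subseteq[n]$ let $\varepsilon_S\in\mathbb R^n$ be its indicator vector. For $I,J\subseteq[n]$ let $\square_{I,J}=\operatorname{conv}\{\varepsilon_S: I\cap J\subseteq S\subseteq I\cup J\}$; it is a $k$-cube when $|I\triangle J|=k$. For $I,J\in M$: $(I,J)$ is a peerless antipode of $M$ in $\square_{I,J}$ if whenever $S,T\in M$ satisfy $S\cap T=I\cap J$ and $S\triangle T=I\triangle J$, then $\{S,T\}=\{I,J\}$; $(I,J)$ is an isolated antipode of $M$ in $\square_{I,J}$ if whenever $S\in M$ satisfies $I\cap J\subseteq S\subseteq I\cup J$, then $S=I$ or $S=J$. "$M$ has a peerless (isolated) antipode in a $k$-cube" means there are $I,J\in M$ with $|I\triangle J|=k$ such that $(I,J)$ is a peerless (isolated) antipode of $M$ in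 $\square_{I,J}$. *)

theory Defs
  imports Main
begin

definition set_system_on :: "nat \<Rightarrow> nat set set \<Rightarrow> bool" where
  "set_system_on n M \<longleftrightarrow> M \<subseteq> Pow {1..n}"

definition delta_matroid :: "nat \<Rightarrow> nat set set \<Rightarrow> bool" where
  "delta_matroid n M \<longleftrightarrow> set_system_on n M \<and>
     (\<forall>A\<in>M. \<forall>B\<in>M. \<forall>a\<in>sym_diff A B. \<exists>b\<in>sym_diff A B. sym_diff A {a, b} \<in> M)"

definition hyperplane_exchange :: "nat set set \<Rightarrow> bool" where
  "hyperplane_exchange M \<longleftrightarrow>
     (\<forall>A\<in>M. \<forall>B\<in>M. A \<noteq> B \<longrightarrow>
       (\<exists>a\<in>sym_diff A B. \<exists>b\<in>sym_diff A B.
          sym_diff A {a, b} \<in> M \<and> sym_diff B {a, b} \<in> M))"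

definition strong_delta_matroid :: "nat \<Rightarrow> nat set set \<Rightarrow> bool" where
  "strong_delta_matroid n M \<longleftrightarrow> delta_matroid n M \<and> hyperplane_exchange M"

(* The cube attached to I, J is the convex hull of the indicator vectors of the S with
   I \<inter> J \<subseteq> S \<subseteq> I \<union> J.  These vectors are exactly its vertices, and antipodes refer
   to the cube only through them, so the cube is represented by the pair I, J and its
   dimension by card (sym_diff I J). *)

definition peerless_antipode :: "nat set set \<Rightarrow> nat set \<Rightarrow> nat set \<Rightarrow> bool" where
  "peerless_antipode M I J \<longleftrightarrow> I \<in> M \<and> J \<in> M \<and>
     (\<forall>S\<in>M. \<forall>T\<in>M. S \<inter> T = I \<inter> J \<and> sym_diff S T = sym_diff I J \<longrightarrow> {S, T} = {I, J})"

definition isolated_antipode :: "nat set set \<Rightarrow> nat set \<Rightarrow> nat set \<Rightarrow> bool" where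
  "isolated_antipode M I J \<longleftrightarrow> I \<in> M \<and> J \<in> M \<and>
     (\<forall>S\<in>M. I \<inter> J \<subseteq> S \<and> S \<subseteq> I \<union> J \<longrightarrow> S = I \<or> S = J)"

definition has_peerless_antipode_in_cube :: "nat set set \<Rightarrow> nat \<Rightarrow> bool" where
  "has_peerless_antipode_in_cube M k \<longleftrightarrow>
     (\<exists>I\<in>M. \<exists>J\<in>M. card (sym_diff I J) = k \<and> peerless_antipode M I J)"

definition has_isolated_antipode_in_cube :: "nat set set \<Rightarrow> nat \<Rightarrow> bool" where
  "has_isolated_antipode_in_cube M k \<longleftrightarrow>
     (\<exists>I\<in>M. \<exists>J\<in>M. card (sym_diff I J) = k \<and> isolated_antipode M I J)"

end

theory Submission
  imports Defs
begin

text \<open>Adjoining a parity element \<open>z\<close> turns \<open>M\<close> into a family \<open>F\<close> of sets of even size, and the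
  conditions on \<open>M\<close> become the symmetric exchange property of even \<open>\<Delta>\<close>-matroids: for all
  \<open>A, B \<in> F\<close> and \<open>a \<in> A \<triangle> B\<close> there is \<open>b \<noteq> a\<close> in \<open>A \<triangle> B\<close> such that \<open>A \<triangle> {a, b}\<close> and
  \<open>B \<triangle> {a, b}\<close> are both in \<open>F\<close>.  The cubes of dimension 3 and 4 give this property at distance 4.
  At larger distance let \<open>a\<close> violate it, and let \<open>{c, d}\<close> avoid \<open>a\<close> with
  \<open>B \<triangle> {c, d} \<in> F\<close>; a set strictly between \<open>A\<close> and \<open>B\<close>, which exists because no antipode
  is isolated, provides such a pair, possibly after swapping \<open>A\<close> and \<open>B\<close>.  Exchange at \<open>a\<close>
  between \<open>A\<close> and \<open>B \<triangle> {c, d}\<close> and then at distance 4 between \<open>B\<close> and the result replaces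
  one of \<open>c, d\<close>, which cannot be exchanged with \<open>a\<close> in \<open>A\<close>,
  by an element that can.  This is impossible more than twice in a row.\<close>

section \<open>Symmetric exchange\<close>

text \<open>Stated for a single pair, so that it can be assumed for closer pairs in an induction.
  For finite sets, \<open>b \<noteq> a\<close> keeps the parity of the cardinality.\<close>

definition symmetric_exchange :: "'a set set \<Rightarrow> 'a set \<Rightarrow> 'a set \<Rightarrow> bool" where
  "symmetric_exchange F A B \<longleftrightarrow> (\<forall>a\<in>sym_diff A B. \<exists>b\<in>sym_diff A B.
     b \<noteq> a \<and> sym_diff A {a, b} \<in> F \<and> sym_diff B {a, b} \<in> F)"

lemma symmetric_exchangeE:
  assumes "symmetric_exchange F A B" "a \<in> sym_diff A B"
  obtains b where "b \<in> sym_diff A B" "b \<noteq> a" "sym_diff A {a, b} \<in> F" "sym_diff B {a, b} \<in> F"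
  using assms unfolding symmetric_exchange_def by blast

lemma sym_diff_eqD: "sym_diff A B = D \<Longrightarrow> B = sym_diff A D"
  by auto

text \<open>Exchanging both elements swaps \<open>A\<close> and \<open>B\<close>.\<close>

lemma symmetric_exchange_two:
  assumes "A \<in> F" "B \<in> F" "sym_diff A B = {p, q}" "p \<noteq> q"
  shows "symmetric_exchange F A B"
proof -
  have "sym_diff A {p, q} = B" "sym_diff B {p, q} = A" using assms(3) by auto
  then have "sym_diff A {p, q} \<in> F" "sym_diff B {p, q} \<in> F" "sym_diff A {q, p} \<in> F" "sym_diff B {q, p} \<in> F"
    using assms(1,2) by (simp_all only: insert_commute[of q p])
  then show ?thesis
    unfolding symmetric_exchange_def assms(3) using assms(4) by (simp only: ball_simps bex_simps) blast
qed

text \<open>The complementary pair comes for free: exchanging \<open>{r, s}\<close> in one set has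
  the same result as exchanging \<open>{p, q}\<close> in the other, so all four elements have
  partners.\<close>

lemma symmetric_exchange_four:
  assumes D: "sym_diff A B = {p, q, r, s}" "distinct [p, q, r, s]"
    and F: "sym_diff A {p, q} \<in> F" "sym_diff B {p, q} \<in> F"
  shows "symmetric_exchange F A B"
proof -
  have B: "B = sym_diff A {p, q, r, s}" using D(1) by (rule sym_diff_eqD)
  have "sym_diff A {r, s} = sym_diff B {p, q}" "sym_diff B {r, s} = sym_diff A {p, q}"
    unfolding B using D(2) by auto
  then have F': "sym_diff A {r, s} \<in> F" "sym_diff B {r, s} \<in> F" using F by auto
  have "sym_diff A {q, p} \<in> F" "sym_diff B {q, p} \<in> F" "sym_diff A {s, r} \<in> F" "sym_diff B {s, r} \<in> F"
    using F F' by (simp_all only: insert_commute)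
  then show ?thesis
    unfolding symmetric_exchange_def D(1)
    using F F' D(2) by (simp only: ball_simps bex_simps distinct.simps list.set) blast
qed

text \<open>\<open>AT\<close> and \<open>BT\<close> serve as induction hypotheses. If
  \<open>a\<close> has no partner, a pair avoiding \<open>a\<close> and exchangeable in
  \<open>B\<close> can always trade an entry outside \<open>N\<close> for one in \<open>N\<close>.
  Two trades put both entries into \<open>N\<close>, and then a third is impossible.\<close>

lemma symmetric_exchange_at:
  assumes AT: "\<And>T. \<lbrakk>T \<in> F; sym_diff A T \<subseteq> sym_diff A B; T \<noteq> A; T \<noteq> B\<rbrakk> \<Longrightarrow> symmetric_exchange F A T"
    and BT: "\<And>T. \<lbrakk>T \<in> F; sym_diff A T \<subseteq> sym_diff A B; T \<noteq> A; T \<noteq> B\<rbrakk> \<Longrightarrow> symmetric_exchange F B T"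
    and card: "card (sym_diff A B) > 4"
    and a: "a \<in> sym_diff A B"
    and cd: "c \<in> sym_diff A B" "d \<in> sym_diff A B" "c \<noteq> d" "a \<noteq> c" "a \<noteq> d" "sym_diff B {c, d} \<in> F"
  shows "\<exists>b\<in>sym_diff A B. b \<noteq> a \<and> sym_diff A {a, b} \<in> F \<and> sym_diff B {a, b} \<in> F"
proof (rule ccontr)
  define D where "D = sym_diff A B"
  have B: "B = sym_diff A D" unfolding D_def by auto
  assume "\<not> ?thesis"
  then have bad: "\<not> (sym_diff A {a, b} \<in> F \<and> sym_diff B {a, b} \<in> F)" if "b \<in> D" "b \<noteq> a" for b
    using that unfolding D_def by blast
  define N where "N = {b. sym_diff A {a, b} \<in> F}"
  define H where "H x y \<longleftrightarrow> x \<in> D \<and> y \<in> D \<and> x \<noteq> y \<and> a \<noteq> x \<and> a \<noteq> y \<and> sym_diff B {x, y} \<in> F" for x y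
  have H_sym: "H x y \<Longrightarrow> H y x" for x y unfolding H_def by (auto simp: insert_commute)
  \<comment> \<open>Distance above 4 keeps the sets at distance 2 or 4 from \<open>B\<close>
    constructed below from being \<open>A\<close>, so that \<open>AT\<close> and \<open>BT\<close>
    apply to them.\<close>
  have small: "\<not> D \<subseteq> {w, x, y, z}" for w x y z
  proof
    assume "D \<subseteq> {w, x, y, z}"
    then have "card D \<le> card {w, x, y, z}" by (intro card_mono) auto
    also have "\<dots> \<le> 4" by (simp add: card_insert_if)
    finally show False using card D_def by simp
  qed
  have aD: "a \<in> D" using a D_def by simp
  have step: "\<exists>v\<in>N. (x \<notin> N \<and> H y v) \<or> (y \<notin> N \<and> H x v)" if "H x y" for x y
  proof -
    have xy: "x \<in> D" "y \<in> D" "x \<noteq> y" "a \<noteq> x" "a \<noteq> y" "sym_diff B {x, y} \<in> F"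
      using that by (auto simp: H_def)
    have diff1: "sym_diff A (sym_diff B {x, y}) = D - {x, y}" using xy B by auto
    have ne: "sym_diff B {x, y} \<noteq> A"
    proof
      assume "sym_diff B {x, y} = A"
      then have "D \<subseteq> {x, y}" unfolding D_def by auto
      then show False using small[of x y x y] by auto
    qed
    have ne': "sym_diff B {x, y} \<noteq> B" by auto
    have "symmetric_exchange F A (sym_diff B {x, y})"
      by (rule AT) (use xy diff1 ne ne' D_def in auto)
    moreover have "a \<in> sym_diff A (sym_diff B {x, y})" using diff1 xy aD by simp
    ultimately obtain v where v: "v \<in> D - {x, y}" "v \<noteq> a" "sym_diff A {a, v} \<in> F"
      "sym_diff (sym_diff B {x, y}) {a, v} \<in> F"
      unfolding diff1[symmetric] by (rule symmetric_exchangeE)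
    \<comment> \<open>Exchanging \<open>a\<close> and \<open>v\<close> in the second set leads to
      \<open>C\<close>, at distance 4 from \<open>B\<close>, with \<open>a\<close> again in the
      difference.\<close>
    define C where "C = sym_diff B {x, y, a, v}"
    have C: "C = sym_diff (sym_diff B {x, y}) {a, v}" using v xy unfolding C_def by auto
    have diff2: "sym_diff B C = {x, y, a, v}" unfolding C_def by auto
    have "sym_diff A C = D - {x, y, a, v}" unfolding C_def B using v xy aD by auto
    moreover have "C \<noteq> B" using diff2 by blast
    moreover have "C \<noteq> A"
    proof
      assume "C = A"
      then have "D = {x, y, a, v}" using diff2 unfolding D_def by blast
      then show False using small[of x y a v] by blast
    qed
    moreover have "C \<in> F" unfolding C by (rule v(4))
    ultimately have "symmetric_exchange F B C" unfolding D_def by (intro BT) blast+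
    moreover have "a \<in> sym_diff B C" unfolding diff2 by blast
    ultimately obtain b where b: "b \<in> {x, y, a, v}" "b \<noteq> a" "sym_diff B {a, b} \<in> F" "sym_diff C {a, b} \<in> F"
      unfolding diff2[symmetric] by (rule symmetric_exchangeE)
    \<comment> \<open>Since \<open>a\<close> and \<open>b\<close> can be exchanged in
      \<open>B\<close>, \<open>bad\<close> forbids it in \<open>A\<close>, whereas \<open>v\<close>
      is exchangeable there. Hence \<open>b\<close> is \<open>x\<close> or \<open>y\<close>, and
      \<open>sym_diff C {a, b}\<close> is \<open>B\<close> with \<open>v\<close> and the other entry
      exchanged.\<close>
    have bN: "b \<notin> N" "b \<noteq> v" using b bad[of b] v xy by (auto simp: N_def)
    have vN: "v \<in> N" using v N_def by simp
    have "b = x \<or> b = y" using b(1,2) bN(2) by auto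
    then show ?thesis
    proof
      assume "b = x"
      have "sym_diff C {a, x} = sym_diff B {y, v}" unfolding C_def using v xy by auto
      then have "H y v" using b \<open>b = x\<close> v xy unfolding H_def by auto
      then show ?thesis using bN vN \<open>b = x\<close> by blast
    next
      assume "b = y"
      have "sym_diff C {a, y} = sym_diff B {x, v}" unfolding C_def using v xy by auto
      then have "H x v" using b \<open>b = y\<close> v xy unfolding H_def by auto
      then show ?thesis using bN vN \<open>b = y\<close> by blast
    qed
  qed
  have "H c d" using cd unfolding H_def D_def by blast
  then obtain x y where "H x y" "y \<in> N" using step by blast
  then obtain u v where "H u v" "u \<in> N" "v \<in> N" using step H_sym by blast
  then show False using step by blast
qed

text \<open>Each \<open>a\<close> lies in only one of \<open>sym_diff A T\<close> and
  \<open>sym_diff B T\<close>. Exchange inside the other one yields the pair avoiding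
  \<open>a\<close> that \<open>symmetric_exchange_at\<close> requires, up to swapping
  \<open>A\<close> and \<open>B\<close>.\<close>

lemma symmetric_exchange_step:
  assumes AT: "\<And>T. \<lbrakk>T \<in> F; sym_diff A T \<subseteq> sym_diff A B; T \<noteq> A; T \<noteq> B\<rbrakk> \<Longrightarrow> symmetric_exchange F A T"
    and BT: "\<And>T. \<lbrakk>T \<in> F; sym_diff A T \<subseteq> sym_diff A B; T \<noteq> A; T \<noteq> B\<rbrakk> \<Longrightarrow> symmetric_exchange F B T"
    and card: "card (sym_diff A B) > 4"
    and T: "T \<in> F" "sym_diff A T \<subseteq> sym_diff A B" "T \<noteq> A" "T \<noteq> B"
  shows "symmetric_exchange F A B"
proof -
  have sub: "sym_diff B T \<subseteq> sym_diff A B" using T(2) by auto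
  have swap: "sym_diff B U \<subseteq> sym_diff B A \<longleftrightarrow> sym_diff A U \<subseteq> sym_diff A B" for U by auto
  have card': "card (sym_diff B A) > 4" using card by (simp add: Un_commute)
  have "\<exists>b\<in>sym_diff A B. b \<noteq> a \<and> sym_diff A {a, b} \<in> F \<and> sym_diff B {a, b} \<in> F"
    if a: "a \<in> sym_diff A B" for a
  proof (cases "a \<in> sym_diff B T")
    case False
    obtain c where c: "c \<in> sym_diff B T" using T(4) by blast
    obtain d where d: "d \<in> sym_diff B T" "d \<noteq> c" "sym_diff B {c, d} \<in> F"
      using symmetric_exchangeE[OF BT[OF T] c] by blast
    have "c \<in> sym_diff A B" "d \<in> sym_diff A B" "c \<noteq> d" "a \<noteq> c" "a \<noteq> d"
      using c d sub False by blast+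
    then show ?thesis
      using symmetric_exchange_at[of F A B a c d, OF AT BT card a] d(3) by blast
  next
    case True
    then have a': "a \<notin> sym_diff A T" using a by blast
    obtain c where c: "c \<in> sym_diff A T" using T(3) by blast
    obtain d where d: "d \<in> sym_diff A T" "d \<noteq> c" "sym_diff A {c, d} \<in> F"
      using symmetric_exchangeE[OF AT[OF T] c] by blast
    have cd: "c \<in> sym_diff B A" "d \<in> sym_diff B A" "c \<noteq> d" "a \<noteq> c" "a \<noteq> d"
      using c d T(2) a' by blast+
    have a'': "a \<in> sym_diff B A" using a by blast
    have "\<exists>b\<in>sym_diff B A. b \<noteq> a \<and> sym_diff B {a, b} \<in> F \<and> sym_diff A {a, b} \<in> F"
      by (rule symmetric_exchange_at[of F B A a c d])
        (use AT BT card' cd a'' d(3) in \<open>simp_all only: swap not_False_eq_True\<close>)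
    then show ?thesis by blast
  qed
  then show ?thesis unfolding symmetric_exchange_def by blast
qed

section \<open>Cubes of dimension 3 and 4\<close>

text \<open>For a second antipodal pair \<open>S\<close>, \<open>T\<close>, the sets
  \<open>sym_diff I S\<close> and \<open>sym_diff I T\<close> are disjoint parts of
  \<open>sym_diff I J\<close>. Exchanging either one turns \<open>I\<close> and \<open>J\<close>
  into \<open>S\<close> and \<open>T\<close> in some order, and one of them has at most half of the
  elements.\<close>

lemma not_peerless_antipodeE:
  assumes M: "I \<in> M" "J \<in> M" and np: "\<not> peerless_antipode M I J" and fin: "finite (sym_diff I J)"
  obtains D where "D \<subseteq> sym_diff I J" "D \<noteq> {}" "2 * card D \<le> card (sym_diff I J)"
    "sym_diff I D \<in> M" "sym_diff J D \<in> M"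
proof -
  have "\<exists>S\<in>M. \<exists>T\<in>M. (S \<inter> T = I \<inter> J \<and> sym_diff S T = sym_diff I J) \<and> {S, T} \<noteq> {I, J}"
    using np unfolding peerless_antipode_def by (simp only: M simp_thms ball_simps not_imp)
  then obtain S T where ST: "S \<in> M" "T \<in> M" "S \<inter> T = I \<inter> J" "sym_diff S T = sym_diff I J" "{S, T} \<noteq> {I, J}"
    by (elim bexE conjE)
  define D where "D = sym_diff I S"
  define D' where "D' = sym_diff I T"
  have sub: "D \<subseteq> sym_diff I J" "D' \<subseteq> sym_diff I J" "D \<inter> D' = {}"
    using ST(3,4) unfolding D_def D'_def by blast+
  have S: "sym_diff I D = S" "sym_diff I D' = T" unfolding D_def D'_def by auto
  have T: "sym_diff J D = T" "sym_diff J D' = S"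
    using ST(3,4) unfolding D_def D'_def by blast+
  have "{S, T} = {I, J}" if "D = {}" using S(1) T(1) that by simp
  moreover have "{S, T} = {I, J}" if "D' = {}" using S(2) T(2) that by (simp add: insert_commute)
  ultimately have ne: "D \<noteq> {}" "D' \<noteq> {}" using ST(5) by blast+
  have "card D + card D' = card (D \<union> D')"
    using sub fin by (metis card_Un_disjoint finite_subset)
  also have "\<dots> \<le> card (sym_diff I J)" using sub fin by (intro card_mono) auto
  finally have "2 * card D \<le> card (sym_diff I J) \<or> 2 * card D' \<le> card (sym_diff I J)" by linarith
  moreover have "sym_diff I D \<in> M" "sym_diff J D \<in> M" "sym_diff I D' \<in> M" "sym_diff J D' \<in> M"
    unfolding S T by (fact ST)+
  ultimately show thesis using that sub(1,2) ne by metis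
qed

text \<open>A nonempty set with at most half of three elements is a singleton.\<close>

lemma three_cube_exchange:
  assumes "I \<in> M" "J \<in> M" "\<not> has_peerless_antipode_in_cube M 3" "card (sym_diff I J) = 3"
  obtains t where "t \<in> sym_diff I J" "sym_diff I {t} \<in> M" "sym_diff J {t} \<in> M"
proof -
  have "\<not> peerless_antipode M I J" using assms unfolding has_peerless_antipode_in_cube_def by blast
  moreover have fin: "finite (sym_diff I J)" using assms(4) by (metis card.infinite zero_neq_numeral)
  ultimately obtain D where D: "D \<subseteq> sym_diff I J" "D \<noteq> {}" "2 * card D \<le> card (sym_diff I J)"
      "sym_diff I D \<in> M" "sym_diff J D \<in> M"
    using not_peerless_antipodeE[OF assms(1,2)] by blast
  have "finite D" using fin D(1) by (rule rev_finite_subset)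
  then have "card D \<noteq> 0" using D(2) by simp
  then have "card D = 1" using D(3) assms(4) by linarith
  then obtain t where "D = {t}" by (rule card_1_singletonE)
  then show thesis using D that[of t] by blast
qed

text \<open>Here \<open>P X\<close> stands for \<open>A \<triangle> X \<in> M\<close>.\<close>

lemma four_cube_pair_of_singleton:
  fixes P :: "'a set \<Rightarrow> bool"
  assumes three: "\<And>E E' x y w. \<lbrakk>P E; P E'; E' = sym_diff E {x, y, w}; distinct [x, y, w]\<rbrakk> \<Longrightarrow>
      \<exists>t\<in>{x, y, w}. P (sym_diff E {t}) \<and> P (sym_diff E' {t})"
    and dist: "distinct [p, q, r, s]"
    and P: "P {}" "P {p}" "P {q, r, s}" "P {p, q, r, s}"
  obtains a b c d where "{a, b, c, d} = {p, q, r, s}" "distinct [a, b, c, d]" "P {a, b}" "P {c, d}"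
proof (rule ccontr)
  note witness = that
  assume neg: "\<not> thesis"
  have bad: "\<not> (P {a, b} \<and> P {c, d})"
    if "{a, b, c, d} = {p, q, r, s}" "distinct [a, b, c, d]" for a b c d
    using that neg witness by blast
  \<comment> \<open>The 3-cubes used here and for \<open>y'\<close> are opposite facets of the
    4-cube: one omits \<open>p\<close>, the other contains it.\<close>
  obtain y where y: "y \<in> {q, r, s}" "P {y}" "P ({q, r, s} - {y})"
  proof -
    have "\<exists>t\<in>{q, r, s}. P (sym_diff {} {t}) \<and> P (sym_diff {q, r, s} {t})"
      by (rule three) (use P dist in auto)
    then obtain t where t: "t \<in> {q, r, s}" "P (sym_diff {} {t})" "P (sym_diff {q, r, s} {t})" by blast
    moreover have "sym_diff {} {t} = {t}" "sym_diff {q, r, s} {t} = {q, r, s} - {t}" using t(1) by auto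
    ultimately show thesis using that by metis
  qed
  obtain y' where y': "y' \<in> {q, r, s}" "P {p, y'}" "P ({p, q, r, s} - {y'})"
  proof -
    have "\<exists>t\<in>{q, r, s}. P (sym_diff {p} {t}) \<and> P (sym_diff {p, q, r, s} {t})"
      by (rule three) (use P dist in auto)
    then obtain t where t: "t \<in> {q, r, s}" "P (sym_diff {p} {t})" "P (sym_diff {p, q, r, s} {t})" by blast
    moreover have "sym_diff {p} {t} = {p, t}" "sym_diff {p, q, r, s} {t} = {p, q, r, s} - {t}"
      using t(1) dist by auto
    ultimately show thesis using that by metis
  qed
  \<comment> \<open>Otherwise \<open>{p, y}\<close> and its complement would be two complementary
    pairs satisfying \<open>P\<close>.\<close>
  have "y \<noteq> y'"
  proof
    assume "y = y'"
    then show False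
      using y y' dist bad[of p q r s] bad[of p r q s] bad[of p s q r]
      by (auto simp: insert_Diff_if insert_commute)
  qed
  then obtain w where w: "{q, r, s} = {y, y', w}" "distinct [p, y, y', w]"
    using y(1) y'(1) dist by auto
  have all: "{p, q, r, s} = {p, y, y', w}" using w by auto
  have "{q, r, s} - {y} = {y', w}" unfolding w(1) using w(2) by auto
  then have y3: "P {y', w}" using y(3) by simp
  have "{p, q, r, s} - {y'} = {p, y, w}" unfolding all using w(2) by auto
  then have y'3: "P {p, y, w}" using y'(3) by simp
  note [simp] = insert_Diff_if insert_commute
  note bad = bad[unfolded all]
  have no: "\<not> P {p, y}" "\<not> P {y, w}" "\<not> (P {p, w} \<and> P {y, y'})"
    using bad[of p y y' w] bad[of y w p y'] bad[of p w y y'] y3 y'(2) w(2) by auto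
  \<comment> \<open>Taking \<open>t = p\<close> would give \<open>{y, w}\<close> and
    \<open>t = w\<close> would give \<open>{p, y}\<close>, both excluded. So \<open>t = y\<close>,
    which gives \<open>{p, w}\<close>.\<close>
  have "\<exists>t\<in>{p, y, w}. P (sym_diff {} {t}) \<and> P (sym_diff {p, y, w} {t})"
    by (rule three) (use P y'3 w(2) in auto)
  then have pw: "P {p, w}" using no w(2) by auto
  \<comment> \<open>Each \<open>t\<close> now produces an excluded pair: \<open>{p, y}\<close>,
    \<open>{y, w}\<close>, or \<open>{y, y'}\<close>, the complement of
    \<open>{p, w}\<close>.\<close>
  have "\<exists>t\<in>{p, y', w}. P (sym_diff {y} {t}) \<and> P (sym_diff {p, y, y', w} {t})"
    by (rule three) (use P(4) all y w(2) in auto)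
  then show False using no pw w(2) by auto
qed

text \<open>A second antipodal pair gives an exchange of one or two elements. A single element is
  converted into a pair by the 3-cube condition. A pair is needed because it preserves
  parity.\<close>

lemma four_cube_exchange:
  assumes M: "A \<in> M" "B \<in> M"
    and np: "\<not> has_peerless_antipode_in_cube M 3" "\<not> has_peerless_antipode_in_cube M 4"
    and card: "card (sym_diff A B) = 4"
  obtains a b c d where "sym_diff A B = {a, b, c, d}" "distinct [a, b, c, d]"
    "sym_diff A {a, b} \<in> M" "sym_diff B {a, b} \<in> M"
proof -
  define D where "D = sym_diff A B"
  have fin: "finite D" using card unfolding D_def by (metis card.infinite zero_neq_numeral)
  have B: "B = sym_diff A D" unfolding D_def by auto
  have "\<not> peerless_antipode M A B" using M np(2) card unfolding has_peerless_antipode_in_cube_def by blast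
  then obtain E where E: "E \<subseteq> D" "E \<noteq> {}" "2 * card E \<le> card D" "sym_diff A E \<in> M" "sym_diff B E \<in> M"
    using not_peerless_antipodeE[OF M] fin unfolding D_def by metis
  have finE: "finite E" using E(1) fin by (rule finite_subset)
  then have "card E \<noteq> 0" using E(2) by simp
  then consider "card E = 1" | "card E = 2" using E(3) card unfolding D_def by linarith
  then show thesis
  proof cases
    case 1
    then obtain p where p: "E = {p}" by (rule card_1_singletonE)
    have "card (D - {p}) = 3" using p E(1) card fin unfolding D_def[symmetric] by simp
    then obtain q r s where qrs: "D - {p} = {q, r, s}" "distinct [q, r, s]"
      unfolding card_3_iff by auto
    have D: "D = {p, q, r, s}" "distinct [p, q, r, s]" using qrs p E(1) by auto
    define P where "P X \<longleftrightarrow> sym_diff A X \<in> M" for X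
    have assoc: "sym_diff (sym_diff A X) Y = sym_diff A (sym_diff X Y)" for X Y by auto
    have three: "\<exists>t\<in>{x, y, w}. P (sym_diff X {t}) \<and> P (sym_diff Y {t})"
      if "P X" "P Y" "Y = sym_diff X {x, y, w}" "distinct [x, y, w]" for X Y x y w
    proof -
      have "sym_diff (sym_diff A X) (sym_diff A Y) = {x, y, w}" using that(3) by auto
      moreover have "card {x, y, w} = 3" using that(4) by simp
      ultimately show ?thesis
        using three_cube_exchange[of "sym_diff A X" M "sym_diff A Y"] that(1,2) np(1)
        unfolding P_def assoc by metis
    qed
    have "sym_diff B E = sym_diff A {q, r, s}" unfolding B using D p by auto
    then have PP: "P {}" "P {p}" "P {q, r, s}" "P {p, q, r, s}"
      using M E p B D unfolding P_def by auto
    obtain a b c d where abcd: "{a, b, c, d} = {p, q, r, s}" "distinct [a, b, c, d]" "P {a, b}" "P {c, d}"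
      using four_cube_pair_of_singleton[OF three D(2) PP] by blast
    have D': "D = {a, b, c, d}" using abcd(1) D(1) by simp
    then have "sym_diff B {a, b} = sym_diff A {c, d}" unfolding B using abcd(2) by auto
    then show thesis using that abcd D' unfolding P_def D_def by metis
  next
    case 2
    then obtain a b where ab: "E = {a, b}" "a \<noteq> b" unfolding card_2_iff by blast
    have "card (D - E) = 2" using 2 E(1) card finE unfolding D_def[symmetric] by (simp add: card_Diff_subset)
    then obtain c d where cd: "D - E = {c, d}" "c \<noteq> d" unfolding card_2_iff by blast
    have "D = {a, b, c, d}" "distinct [a, b, c, d]" using ab cd E(1) by auto
    then show thesis using that ab E(4,5) unfolding D_def by blast
  qed
qed

section \<open>The even lift\<close>

text \<open>If the members of \<open>M\<close> are finite and avoid \<open>z\<close>, deleting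
  \<open>z\<close> is a bijection onto \<open>M\<close>, with inverse \<open>lift_set z\<close>;
  thus \<open>z\<close> only records parity.\<close>

definition even_lift :: "'a \<Rightarrow> 'a set set \<Rightarrow> 'a set set" where
  "even_lift z M = {S. finite S \<and> even (card S) \<and> S - {z} \<in> M}"

definition lift_set :: "'a \<Rightarrow> 'a set \<Rightarrow> 'a set" where
  "lift_set z S = (if even (card S) then S else insert z S)"

lemma lift_set_Diff [simp]: "z \<notin> S \<Longrightarrow> lift_set z S - {z} = S"
  unfolding lift_set_def by auto

lemma lift_set_in_even_lift: "\<lbrakk>S \<in> M; finite S; z \<notin> S\<rbrakk> \<Longrightarrow> lift_set z S \<in> even_lift z M"
  unfolding even_lift_def lift_set_def by (auto simp: card_insert_if)

lemma even_card_sym_diff: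
  assumes "finite A" "finite B"
  shows "even (card (sym_diff A B)) \<longleftrightarrow> (even (card A) \<longleftrightarrow> even (card B))"
proof -
  have "card (sym_diff A B) = card (A - B) + card (B - A)"
    using assms by (intro card_Un_disjoint) auto
  moreover have "card A = card (A - B) + card (A \<inter> B)" "card B = card (B - A) + card (A \<inter> B)"
    using assms by (metis Int_Diff_Un Int_Diff_disjoint card_Un_disjoint finite_Diff finite_Int add.commute inf_commute)+
  ultimately show ?thesis by presburger
qed

text \<open>Induction on the dimension of the cube in \<open>M\<close>. The measure ignores
  \<open>z\<close> because a member of \<open>M\<close> inside the cube may have a lift that leaves
  the interval at \<open>z\<close>.\<close>

lemma symmetric_exchange_even_lift:
  fixes M :: "nat set set"
  assumes z: "\<And>S. S \<in> M \<Longrightarrow> z \<notin> S" and fin: "\<And>S. S \<in> M \<Longrightarrow> finite S"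
    and np: "\<not> has_peerless_antipode_in_cube M 3" "\<not> has_peerless_antipode_in_cube M 4"
    and ni: "\<And>k. k \<ge> 5 \<Longrightarrow> \<not> has_isolated_antipode_in_cube M k"
    and AB: "A \<in> even_lift z M" "B \<in> even_lift z M"
  shows "symmetric_exchange (even_lift z M) A B"
  using AB
proof (induction "card (sym_diff A B - {z})" arbitrary: A B rule: less_induct)
  case less
  define F where "F = even_lift z M"
  define D where "D = sym_diff A B"
  define A0 where "A0 = A - {z}"
  define B0 where "B0 = B - {z}"
  have AB: "finite A" "finite B" "even (card A)" "even (card B)" "A0 \<in> M" "B0 \<in> M"
    using less.prems by (auto simp: even_lift_def A0_def B0_def)
  have finD: "finite D" unfolding D_def using AB by auto
  have evenD: "even (card D)" unfolding D_def using AB even_card_sym_diff by blast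
  have D0: "sym_diff A0 B0 = D - {z}" unfolding A0_def B0_def D_def by auto
  have F_sym: "sym_diff X {a, b} \<in> F" if "X \<in> F" "a \<noteq> b" "sym_diff X {a, b} - {z} \<in> M" for X a b
  proof -
    have "even (card (sym_diff X {a, b}))"
      using that even_card_sym_diff[of X "{a, b}"] by (simp add: F_def even_lift_def)
    then show ?thesis using that by (simp add: F_def even_lift_def)
  qed
  have AF: "A \<in> F" "B \<in> F" using less.prems by (auto simp: F_def)
  have IH: "symmetric_exchange F X Y"
    if "X \<in> F" "Y \<in> F" "sym_diff X Y - {z} \<subset> D - {z}" for X Y
    using less.hyps[of X Y] that psubset_card_mono[OF _ that(3)] finD unfolding F_def D_def by simp
  consider "card (D - {z}) \<le> 2" | "card (D - {z}) = 3" | "card (D - {z}) = 4" | "card (D - {z}) \<ge> 5"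
    by linarith
  then have "symmetric_exchange F A B"
  proof cases
    case 1
    have "card D \<le> 3" using 1 finD by (cases "z \<in> D") auto
    then have "card D = 0 \<or> card D = 2" using evenD by presburger
    then show ?thesis
    proof
      assume "card D = 0"
      then have "D = {}" using finD by simp
      then show ?thesis unfolding symmetric_exchange_def D_def[symmetric] by blast
    next
      assume "card D = 2"
      then obtain p q where "D = {p, q}" "p \<noteq> q" unfolding card_2_iff by blast
      then show ?thesis using symmetric_exchange_two AF D_def by metis
    qed
  next
    case 2
    \<comment> \<open>Parity forces \<open>z\<close> into the difference, so a single exchange in
      \<open>M\<close> becomes an exchange of a pair with \<open>z\<close>.\<close>
    have zD: "z \<in> D" using 2 evenD by (cases "z \<in> D") auto
    obtain t where t: "t \<in> D - {z}" "sym_diff A0 {t} \<in> M" "sym_diff B0 {t} \<in> M"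
      using three_cube_exchange[OF AB(5,6) np(1)] 2 D0 by metis
    have "card (D - {z} - {t}) = 2" using 2 t finD by simp
    then obtain r s where rs: "D - {z} - {t} = {r, s}" "r \<noteq> s" unfolding card_2_iff by blast
    have D: "D = {t, z, r, s}" "distinct [t, z, r, s]" using rs t zD by auto
    have "sym_diff A {t, z} - {z} = sym_diff A0 {t}" "sym_diff B {t, z} - {z} = sym_diff B0 {t}"
      using t(1) unfolding A0_def B0_def by auto
    then have "sym_diff A {t, z} \<in> F" "sym_diff B {t, z} \<in> F"
      using F_sym AF t by auto
    then show ?thesis using symmetric_exchange_four D unfolding D_def by metis
  next
    case 3
    have zD: "z \<notin> D"
    proof
      assume "z \<in> D"
      then have "card D = 5" using 3 card_Suc_Diff1[OF finD] by simp
      then show False using evenD by simp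
    qed
    obtain a b c d where D: "D = {a, b, c, d}" "distinct [a, b, c, d]"
      "sym_diff A0 {a, b} \<in> M" "sym_diff B0 {a, b} \<in> M"
      using four_cube_exchange[OF AB(5,6) np] 3 D0 zD by (metis Diff_empty Diff_insert0)
    have "sym_diff A {a, b} - {z} = sym_diff A0 {a, b}" "sym_diff B {a, b} - {z} = sym_diff B0 {a, b}"
      using zD D(1) unfolding A0_def B0_def by auto
    then have "sym_diff A {a, b} \<in> F" "sym_diff B {a, b} \<in> F"
      using F_sym AF D by auto
    then show ?thesis using symmetric_exchange_four D unfolding D_def by metis
  next
    case 4
    have "\<not> isolated_antipode M A0 B0"
      using ni[of "card (D - {z})"] 4 AB(5,6) D0 unfolding has_isolated_antipode_in_cube_def by metis
    then obtain S where S: "S \<in> M" "A0 \<inter> B0 \<subseteq> S" "S \<subseteq> A0 \<union> B0" "S \<noteq> A0" "S \<noteq> B0"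
      using AB unfolding isolated_antipode_def by blast
    have zS: "z \<notin> S" using z S by blast
    define T where "T = lift_set z S"
    have TF: "T \<in> F" using lift_set_in_even_lift S fin zS unfolding T_def F_def by metis
    have T0: "T - {z} = S" using zS unfolding T_def by simp
    have SD: "sym_diff A0 S \<subset> D - {z}" "sym_diff B0 S \<subset> D - {z}"
      using S unfolding D0[symmetric] by auto
    have AT0: "sym_diff A T - {z} = sym_diff A0 S" "sym_diff B T - {z} = sym_diff B0 S"
      using T0 by (auto simp: A0_def B0_def)
    have "\<exists>T\<in>F. sym_diff A T \<subseteq> D \<and> T \<noteq> A \<and> T \<noteq> B"
    proof (cases "sym_diff A T \<subseteq> D")
      case True
      moreover have "T \<noteq> A" "T \<noteq> B" using T0 S by (auto simp: A0_def B0_def)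
      ultimately show ?thesis using TF by blast
    next
      case False
      moreover have "sym_diff A T - {z} \<subseteq> D" using SD(1) unfolding AT0 by blast
      ultimately have zD: "z \<notin> D" "z \<in> sym_diff A T" by blast+
      then have zB: "z \<in> sym_diff B T" unfolding D_def by blast
      \<comment> \<open>\<open>T\<close> lies between \<open>A\<close> and \<open>B\<close> except at \<open>z\<close>; exchange at \<open>z\<close> moves it into the interval\<close>
      have repair: ?thesis if X: "X = A \<or> X = B" "card (sym_diff X T - {z}) \<ge> 2" for X
      proof -
        have sub: "sym_diff X T - {z} \<subset> D - {z}" using X(1) by (elim disjE) (simp_all only: AT0 SD)
        have "X \<in> F" using X(1) AF by blast
        then have "symmetric_exchange F X T" using IH TF sub by blast
        moreover have zX: "z \<in> sym_diff X T" using X(1) zD zB by blast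
        ultimately obtain b where b: "b \<in> sym_diff X T" "b \<noteq> z" "sym_diff T {z, b} \<in> F"
          by (rule symmetric_exchangeE)
        \<comment> \<open>Otherwise the repaired set would be \<open>X\<close> itself; this is why
          two elements besides \<open>z\<close> are required.\<close>
        have "sym_diff X T \<noteq> {z, b}"
        proof
          assume "sym_diff X T = {z, b}"
          then have "card (sym_diff X T - {z}) \<le> card {b}" by (intro card_mono) auto
          then show False using X(2) by simp
        qed
        then have "sym_diff T {z, b} \<noteq> X" by auto
        \<comment> \<open>Properness of the inclusion excludes the opposite end of the
          interval.\<close>
        moreover have "sym_diff X (sym_diff T {z, b}) \<subset> D"
          using sub b zX by auto
        ultimately obtain U where U: "U \<in> F" "U \<noteq> X" "sym_diff X U \<subset> D" using b(3) by blast
        have "U \<noteq> A \<and> U \<noteq> B \<and> sym_diff A U \<subseteq> D"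
          using X(1)
        proof
          assume "X = A"
          then show ?thesis using U(2,3) unfolding D_def by blast
        next
          assume "X = B"
          then show ?thesis using U(2,3) unfolding D_def by blast
        qed
        then show ?thesis using U(1) by blast
      qed
      \<comment> \<open>The two differences cover at least five elements, so one of them has two
        elements besides \<open>z\<close>.\<close>
      have "D - {z} \<subseteq> (sym_diff A T - {z}) \<union> (sym_diff B T - {z})" unfolding D_def by auto
      moreover have "finite ((sym_diff A T - {z}) \<union> (sym_diff B T - {z}))"
        using AB TF by (auto simp: F_def even_lift_def)
      ultimately have "card (D - {z}) \<le> card ((sym_diff A T - {z}) \<union> (sym_diff B T - {z}))"
        by (rule card_mono[rotated])
      also have "\<dots> \<le> card (sym_diff A T - {z}) + card (sym_diff B T - {z})" by (rule card_Un_le)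
      finally have "card (sym_diff A T - {z}) \<ge> 2 \<or> card (sym_diff B T - {z}) \<ge> 2"
        using 4 by linarith
      then show ?thesis using repair[of A] repair[of B] by (elim disjE) (simp_all only: simp_thms)
    qed
    then obtain U where U: "U \<in> F" "sym_diff A U \<subseteq> sym_diff A B" "U \<noteq> A" "U \<noteq> B"
      unfolding D_def by blast
    have strict: "sym_diff A V - {z} \<subset> D - {z}" "sym_diff B V - {z} \<subset> D - {z}"
      if V: "V \<in> F" "sym_diff A V \<subseteq> sym_diff A B" "V \<noteq> A" "V \<noteq> B" for V
    proof -
      \<comment> \<open>Sets that differ only at \<open>z\<close> have opposite parity, so distinct
        members of \<open>F\<close> differ elsewhere and the measure drops strictly.\<close>
      have differ: "X - {z} \<noteq> Y - {z}" if "X \<in> F" "Y \<in> F" "X \<noteq> Y" for X Y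
      proof
        assume eq: "X - {z} = Y - {z}"
        then have "sym_diff X Y = {z}" using that(3) by auto
        moreover have "even (card (sym_diff X Y))"
          using that even_card_sym_diff unfolding F_def even_lift_def by blast
        ultimately show False by simp
      qed
      show "sym_diff A V - {z} \<subset> D - {z}" "sym_diff B V - {z} \<subset> D - {z}"
        using differ[OF V(1) AF(1) V(3)] differ[OF V(1) AF(2) V(4)] V(2) unfolding D_def by blast+
    qed
    have card: "card (sym_diff A B) > 4"
      using 4 card_mono[OF finD Diff_subset[of D "{z}"]] unfolding D_def[symmetric] by linarith
    show ?thesis
    proof (rule symmetric_exchange_step[OF _ _ card U])
      fix V assume V: "V \<in> F" "sym_diff A V \<subseteq> sym_diff A B" "V \<noteq> A" "V \<noteq> B"
      show "symmetric_exchange F A V" by (rule IH[OF AF(1) V(1) strict(1)[OF V]])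
      show "symmetric_exchange F B V" by (rule IH[OF AF(2) V(1) strict(2)[OF V]])
    qed
  qed
  then show ?case unfolding F_def .
qed

section \<open>Passage between strong exchange and the cube conditions\<close>

theorem proposition3p20:
  fixes n :: nat and M :: "nat set set"
  assumes "set_system_on n M"
  shows "strong_delta_matroid n M \<longleftrightarrow>
    \<not> has_peerless_antipode_in_cube M 3 \<and>
    \<not> has_peerless_antipode_in_cube M 4 \<and>
    (\<forall>k\<ge>5. \<not> has_isolated_antipode_in_cube M k)"
proof
  assume "strong_delta_matroid n M"
  then have hyp: "hyperplane_exchange M" unfolding strong_delta_matroid_def by blast
  \<comment> \<open>An exchanged pair has at most two elements, so in dimension at least 3 it is a
    proper part of the difference and yields a new antipodal pair.\<close>
  have exch: "\<exists>D\<subseteq>sym_diff I J. D \<noteq> {} \<and> D \<noteq> sym_diff I J \<and> sym_diff I D \<in> M \<and> sym_diff J D \<in> M"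
    if IJ: "I \<in> M" "J \<in> M" "card (sym_diff I J) \<ge> 3" for I J
  proof -
    have "I \<noteq> J" using IJ(3) by auto
    then obtain a b where ab: "a \<in> sym_diff I J" "b \<in> sym_diff I J"
      "sym_diff I {a, b} \<in> M" "sym_diff J {a, b} \<in> M"
      using hyp IJ unfolding hyperplane_exchange_def by blast
    have "card {a, b} \<le> 2" by (simp add: card_insert_if)
    then have "{a, b} \<noteq> sym_diff I J" using IJ(3) by auto
    then show ?thesis using ab by (intro exI[of _ "{a, b}"]) blast
  qed
  have "\<not> peerless_antipode M I J" if IJ: "I \<in> M" "J \<in> M" "card (sym_diff I J) \<ge> 3" for I J
  proof -
    obtain D where D: "D \<subseteq> sym_diff I J" "D \<noteq> {}" "D \<noteq> sym_diff I J" "sym_diff I D \<in> M" "sym_diff J D \<in> M"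
      using exch[OF IJ] by (elim exE conjE)
    have "sym_diff I D \<inter> sym_diff J D = I \<inter> J" "sym_diff (sym_diff I D) (sym_diff J D) = sym_diff I J"
      using D(1) by auto
    moreover have "sym_diff I D \<noteq> I" "sym_diff I D \<noteq> J" using D(1-3) by auto
    ultimately show ?thesis using D(4,5) unfolding peerless_antipode_def by (metis insert_iff singletonD)
  qed
  moreover have "\<not> isolated_antipode M I J" if IJ: "I \<in> M" "J \<in> M" "card (sym_diff I J) \<ge> 3" for I J
  proof -
    obtain D where D: "D \<subseteq> sym_diff I J" "D \<noteq> {}" "D \<noteq> sym_diff I J" "sym_diff I D \<in> M"
      using exch[OF IJ] by (elim exE conjE)
    have "I \<inter> J \<subseteq> sym_diff I D" "sym_diff I D \<subseteq> I \<union> J" "sym_diff I D \<noteq> I" "sym_diff I D \<noteq> J"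
      using D(1-3) by auto
    then show ?thesis using D(4) unfolding isolated_antipode_def by blast
  qed
  ultimately have "\<not> has_peerless_antipode_in_cube M k" "\<not> has_isolated_antipode_in_cube M k"
    if "k \<ge> 3" for k
    using that unfolding has_peerless_antipode_in_cube_def has_isolated_antipode_in_cube_def by blast+
  then show "\<not> has_peerless_antipode_in_cube M 3 \<and> \<not> has_peerless_antipode_in_cube M 4 \<and>
      (\<forall>k\<ge>5. \<not> has_isolated_antipode_in_cube M k)"
    by simp
next
  assume cubes: "\<not> has_peerless_antipode_in_cube M 3 \<and> \<not> has_peerless_antipode_in_cube M 4 \<and>
    (\<forall>k\<ge>5. \<not> has_isolated_antipode_in_cube M k)"
  \<comment> \<open>The ground set starts at 1, which leaves \<open>0\<close> free as the parity
    element.\<close>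
  have z: "0 \<notin> S" and fin: "finite S" if "S \<in> M" for S
  proof -
    have "S \<subseteq> {1..n}" using assms that unfolding set_system_on_def by blast
    then show "0 \<notin> S" "finite S" using finite_subset by auto
  qed
  \<comment> \<open>This implies both defining conditions: one forgets the exchange in
    \<open>B\<close>, the other fixes an arbitrary \<open>a\<close>.\<close>
  have exch: "\<exists>b\<in>sym_diff A B. sym_diff A {a, b} \<in> M \<and> sym_diff B {a, b} \<in> M"
    if AB: "A \<in> M" "B \<in> M" and a: "a \<in> sym_diff A B" for A B a
  proof -
    let ?A = "lift_set 0 A" and ?B = "lift_set 0 B"
    have lift: "?A - {0} = A" "?B - {0} = B" using z AB by auto
    have a0: "a \<noteq> 0" using a z[OF AB(1)] z[OF AB(2)] by (cases "a = 0") simp_all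
    have "?A \<in> even_lift 0 M" "?B \<in> even_lift 0 M"
      using AB z fin by (simp_all add: lift_set_in_even_lift)
    then have "symmetric_exchange (even_lift 0 M) ?A ?B"
      using symmetric_exchange_even_lift[of M 0] z fin cubes by blast
    moreover have "a \<in> sym_diff ?A ?B" using a a0 lift by blast
    ultimately obtain b where b: "b \<in> sym_diff ?A ?B" "b \<noteq> a"
      "sym_diff ?A {a, b} \<in> even_lift 0 M" "sym_diff ?B {a, b} \<in> even_lift 0 M"
      by (rule symmetric_exchangeE)
    \<comment> \<open>partner \<open>0\<close> in the lift means that \<open>a\<close> is exchanged alone\<close>
    define b' where "b' = (if b = 0 then a else b)"
    have "sym_diff ?A {a, b} - {0} = sym_diff A {a, b'}" "sym_diff ?B {a, b} - {0} = sym_diff B {a, b'}"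
      using lift a0 unfolding b'_def by auto
    moreover have "b' \<in> sym_diff A B" using b(1) a lift unfolding b'_def by auto
    ultimately show ?thesis using b(3,4) unfolding even_lift_def by auto
  qed
  have "delta_matroid n M"
    using assms exch unfolding delta_matroid_def by meson
  moreover have "hyperplane_exchange M"
    unfolding hyperplane_exchange_def
  proof (intro ballI impI)
    fix A B assume AB: "A \<in> M" "B \<in> M" "A \<noteq> B"
    then obtain a where "a \<in> sym_diff A B" by blast
    then show "\<exists>a\<in>sym_diff A B. \<exists>b\<in>sym_diff A B. sym_diff A {a, b} \<in> M \<and> sym_diff B {a, b} \<in> M"
      using exch[OF AB(1,2)] by blast
  qed
  ultimately show "strong_delta_matroid n M" unfolding strong_delta_matroid_def by blast
qed

end
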